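(* Let $q$ be an odd prime power, $t\geq 3$, $n=2t$, and let $h\in\mathbb{F}_{q^n}\setminus\mathbb{F}_{q^t}$ with $h^{q^t+1}=-1$. Let $\psi_{h,t}(x)= x^{q}+x^{q^{t-1}}-h^{1-q^{t+1}}x^{q^{t+1}}+h^{1-q^{2t-1}}x^{q^{2t-1}}$, let $\hat\psi_{h,t}$ be its adjoint map, $\mathcal{C}_{h,t}=\{ax+b\psi_{h,t}(x):a,b\in\mathbb{F}_{q^n}\}$ and $\hat{\mathcal{C}}_{h,t}=\{ax+b\hat\psi_{h,t}(x):a,b\in\mathbb{F}_{q^n}\}$. Then $\hat{\mathcal{C}}_{h,t}$ is equivalent to $\mathcal{C}_{h,t}$.
   Context: For a $q$-polynomial $f(x)=\sum_{i=0}^{n-1}a_ix^{q^i}$ over $\mathbb{F}_{q^n}$, its adjoint with respect to the bilinear form $\langle x,y\rangle=\mathrm{Tr}_{q^n/q}(xy)$ is $\hat f(x)=a_0x+\sum_{i=1}^{n-1}a_i^{q^{n-i}}x^{q^{n-i}}$. $q$-polynomials (modulo $x^{q^n}-x$) are identified with $\mathbb{F}_q$-linear maps of $\mathbb{F}_{q^n}$; for $\varphi=\sum a_ix^{q^i}$ and $\rho\in\operatorname{Aut}(\mathbb{F}_{q^n})$, $\varphi^\rho=\sum a_i^\rho x^{q^i}$. Two sets $\mathcal{C},\mathcal{C}'$ of $q$-polynomials are equivalent if there exist invertible $q$-polynomials $L_1,L_2$ and $\rho\in\operatorname{Aut}(\mathbb{F}_{q^n})$ with $\mathcal{C}'=\{L_1\circ\varphi^\rho\circ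 L_2:\varphi\in\mathcal{C}\}$. *)

theory Defs
  imports
    "HOL-Computational_Algebra.Polynomial"
    "HOL-Number_Theory.Prime_Powers"
    "HOL-Library.Cardinality"
begin

text \<open>
  Throughout, the field with \<open>q ^ n\<close> elements is a type \<open>'a :: {field, finite}\<close> with
  \<open>CARD('a) = q ^ n\<close>. A \<open>q\<close>-polynomial is a polynomial over \<open>'a\<close> whose only exponents are
  \<open>q ^ i\<close> with \<open>i < n\<close>, i.e. the reduced representative of a class modulo \<open>X ^ (q ^ n) - X\<close>;
  the map it is identified with is \<^term>\<open>poly f\<close>.
\<close>

definition q_polynomial :: "nat \<Rightarrow> nat \<Rightarrow> 'a::{field,finite} poly \<Rightarrow> bool" where
  "q_polynomial q n f \<longleftrightarrow> (\<exists>a. f = (\<Sum>i<n. monom (a i) (q ^ i)))"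

text \<open>The coefficient \<open>a\<^sub>i\<close> of a \<open>q\<close>-polynomial is \<^term>\<open>coeff f (q ^ i)\<close>.\<close>

definition adjoint_poly :: "nat \<Rightarrow> nat \<Rightarrow> 'a::{field,finite} poly \<Rightarrow> 'a poly" where
  "adjoint_poly q n f =
     monom (coeff f (q ^ 0)) 1 +
     (\<Sum>i=1..<n. monom (coeff f (q ^ i) ^ (q ^ (n - i))) (q ^ (n - i)))"

text \<open>Composition of \<open>q\<close>-polynomials, reduced modulo \<open>X ^ (q ^ n) - X\<close>.\<close>

definition qcomp :: "nat \<Rightarrow> nat \<Rightarrow> 'a::{field,finite} poly \<Rightarrow> 'a poly \<Rightarrow> 'a poly" where
  "qcomp q n f g = pcompose f g mod (monom 1 (q ^ n) - monom 1 1)"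

definition invertible_q_polynomial :: "nat \<Rightarrow> nat \<Rightarrow> 'a::{field,finite} poly \<Rightarrow> bool" where
  "invertible_q_polynomial q n f \<longleftrightarrow> q_polynomial q n f \<and> bij (poly f)"

definition field_automorphism :: "('a::field \<Rightarrow> 'a) \<Rightarrow> bool" where
  "field_automorphism \<rho> \<longleftrightarrow>
     bij \<rho> \<and> (\<forall>x y. \<rho> (x + y) = \<rho> x + \<rho> y) \<and> (\<forall>x y. \<rho> (x * y) = \<rho> x * \<rho> y)"

definition q_equivalent ::
    "nat \<Rightarrow> nat \<Rightarrow> 'a::{field,finite} poly set \<Rightarrow> 'a poly set \<Rightarrow> bool" where
  "q_equivalent q n C C' \<longleftrightarrow>
     (\<exists>L\<^sub>1 L\<^sub>2 \<rho>. invertible_q_polynomial q n L\<^sub>1 \<and> invertible_q_polynomial q n L\<^sub>2 \<and>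
        field_automorphism \<rho> \<and>
        C' = {qcomp q n L\<^sub>1 (qcomp q n (map_poly \<rho> \<phi>) L\<^sub>2) | \<phi>. \<phi> \<in> C})"

text \<open>
  In a finite field of order \<open>q ^ n\<close> with \<open>m\<close> dividing \<open>n\<close>, the unique subfield of order
  \<open>r = q ^ m\<close> is the set of fixed points of \<open>x \<mapsto> x ^ r\<close>.
\<close>

definition GF_subfield :: "nat \<Rightarrow> 'a::{field,finite} set" where
  "GF_subfield r = {x. x ^ r = x}"

definition psi :: "nat \<Rightarrow> nat \<Rightarrow> 'a::{field,finite} \<Rightarrow> 'a poly" where
  "psi q t h =
     monom 1 q + monom 1 (q ^ (t - 1))
     - monom (h powi (1 - int (q ^ (t + 1)))) (q ^ (t + 1))
     + monom (h powi (1 - int (q ^ (2 * t - 1)))) (q ^ (2 * t - 1))"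

definition code_of :: "'a::{field,finite} poly \<Rightarrow> 'a poly set" where
  "code_of f = {monom a 1 + smult b f | a b. True}"

end

theory Submission
  imports Defs
begin

text \<open>
  Write \<open>s\<close> and \<open>T\<close> for the powers \<open>q\<close> and \<open>q ^ t\<close> of the Frobenius and \<open>r\<close> for the inverse of
  \<open>s\<close>. Since \<open>T h = - 1 / h\<close>, composing the adjoint of \<open>\<psi>\<close> with \<open>e \<psi>\<close>, where
  \<open>e = r h / (h (s h r h - 1))\<close>, kills all terms except a nonzero multiple of the identity.
  Right composition with \<open>L\<^sub>2 = e \<psi>\<close> therefore exchanges the two generators of the codes, so
  \<open>L\<^sub>1 = x\<close> and \<open>\<rho> = id\<close> suffice.
\<close>

section \<open>Finite fields: order, characteristic and additivity of Frobenius powers\<close>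

lemma finite_field_power_CARD:
  fixes x :: "'a::{field,finite}"
  shows "x ^ CARD('a) = x"
proof (cases "x = 0")
  case False
  let ?U = "UNIV - {0 :: 'a}"
  have "bij_betw ((*) x) ?U ?U"
    using False by (intro bij_betwI[of _ _ _ "\<lambda>y. y / x"]) auto
  \<comment> \<open>Multiplication by \<open>x\<close> permutes the nonzero elements, so their
    product absorbs the factor \<open>x ^ card ?U\<close>.\<close>
  from prod.reindex_bij_betw[OF this, of id]
  have "x ^ card ?U * \<Prod>?U = \<Prod>?U"
    by (simp add: prod.distrib)
  moreover have "\<Prod>?U \<noteq> 0"
    by simp
  ultimately have "x ^ card ?U = 1"
    by simp
  moreover have "CARD('a) = Suc (card ?U)"
    by (rule card.remove) simp_all
  ultimately show ?thesis
    by (simp only: power_Suc mult_1_right)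
qed simp

lemma prime_CHAR_finite_field: "prime CHAR('a::{field,finite})"
  by (rule prime_CHAR_semidom) (rule finite_imp_CHAR_pos[OF finite])

text \<open>Translation by 1 permutes the field, so adding 1 to every summand leaves the sum of all
  elements unchanged.\<close>

lemma CHAR_dvd_CARD_finite_field: "CHAR('a::{field,finite}) dvd CARD('a)"
proof -
  have "(\<Sum>x\<in>UNIV. x + 1 :: 'a) = (\<Sum>x\<in>UNIV. x)"
    by (rule sum.reindex_bij_witness[of _ "\<lambda>x. x - 1" "\<lambda>x. x + 1"]) auto
  hence "of_nat CARD('a) = (0 :: 'a)"
    by (simp add: sum.distrib)
  thus ?thesis
    by (simp only: of_nat_eq_0_iff_char_dvd)
qed

text \<open>The characteristic divides the order \<open>q ^ n\<close>, so it is the prime below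
  \<open>q\<close>, and the freshman's dream applies.\<close>

lemma add_power_primepow:
  fixes x y :: "'a::{field,finite}"
  assumes "primepow q" and "CARD('a) = q ^ n"
  shows "(x + y) ^ (q ^ i) = x ^ (q ^ i) + y ^ (q ^ i)"
proof -
  from assms(1) obtain p k where p: "prime p" and q: "q = p ^ k"
    by (auto simp: primepow_def)
  have "CHAR('a) dvd p ^ (k * n)"
    using CHAR_dvd_CARD_finite_field[where ?'a = 'a] assms(2) by (simp add: q power_mult)
  hence "CHAR('a) = p"
    using prime_CHAR_finite_field p by (metis prime_dvd_power primes_dvd_imp_eq)
  thus ?thesis
    using freshmans_dream'[where ?'a = 'a, OF prime_CHAR_finite_field, of "q ^ i" "k * i"] by (simp add: q power_mult)
qed

lemma two_neq_zero_odd_CARD: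
  assumes "odd CARD('a::{field,finite})"
  shows "(2 :: 'a) \<noteq> 0"
proof
  assume "(2 :: 'a) = 0"
  hence "CHAR('a) dvd 2"
    using of_nat_eq_0_iff_char_dvd[where ?'a = 'a, of 2] by simp
  hence "CHAR('a) = 2"
    using prime_CHAR_finite_field[where ?'a = 'a] by (simp add: primes_dvd_imp_eq)
  thus False
    using assms CHAR_dvd_CARD_finite_field[where ?'a = 'a] by simp
qed

section \<open>Reduced composition and closure properties of q-polynomials\<close>

text \<open>The modulus \<open>X ^ (q ^ n) - X\<close> vanishes on the whole field, so reduction
  does not change values.\<close>

lemma poly_qcomp:
  fixes f g :: "'a::{field,finite} poly"
  assumes "CARD('a) = q ^ n"
  shows "poly (qcomp q n f g) x = poly f (poly g x)"
proof -
  have "x ^ (q ^ n) = x"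
    using finite_field_power_CARD[of x] assms by simp
  thus ?thesis
    by (simp add: qcomp_def poly_mod poly_pcompose poly_monom)
qed

lemma degree_qcomp_less:
  fixes f g :: "'a::{field,finite} poly"
  assumes "q ^ n > 1"
  shows "degree (qcomp q n f g) < q ^ n"
proof -
  let ?m = "monom 1 (q ^ n) - monom 1 1 :: 'a poly"
  have "degree ?m = q ^ n"
    using assms degree_add_eq_left[of "- monom 1 1 :: 'a poly" "monom 1 (q ^ n)"]
    by (simp add: degree_monom_eq)
  moreover from this have "?m \<noteq> 0"
    using assms by (metis degree_0 not_one_less_zero)
  ultimately show ?thesis
    using degree_mod_less[of ?m "pcompose f g"] assms
    by (metis qcomp_def degree_0 order.strict_trans zero_less_one)
qed

text \<open>Both polynomials have degree below the number of field elements, so equal values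
  everywhere force equal polynomials.\<close>

lemma qcomp_eqI:
  fixes f g :: "'a::{field,finite} poly"
  assumes "CARD('a) = q ^ n" and "q ^ n > 1" and "degree p < q ^ n"
    and "\<And>x. poly f (poly g x) = poly p x"
  shows "qcomp q n f g = p"
  by (rule poly_eqI_degree[of UNIV])
     (use assms degree_qcomp_less in \<open>simp_all add: poly_qcomp\<close>)

lemma q_polynomial_monom: "i < n \<Longrightarrow> q_polynomial q n (monom c (q ^ i))"
  unfolding q_polynomial_def
  by (rule exI[of _ "\<lambda>j. if j = i then c else 0"])
     (subst sum.mono_neutral_right[of _ "{i}"], auto)

lemma q_polynomial_add: "q_polynomial q n f \<Longrightarrow> q_polynomial q n g \<Longrightarrow> q_polynomial q n (f + g)"
  unfolding q_polynomial_def by (auto simp: add_monom sum.distrib[symmetric])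

lemma q_polynomial_smult:
  assumes "q_polynomial q n f"
  shows "q_polynomial q n (smult c f)"
proof -
  obtain a where "f = (\<Sum>i<n. monom (a i) (q ^ i))"
    using assms by (auto simp: q_polynomial_def)
  hence "smult c f = (\<Sum>i<n. monom (c * a i) (q ^ i))"
    by (simp add: poly_eq_iff coeff_sum sum_distrib_left if_distrib cong: if_cong)
  thus ?thesis
    unfolding q_polynomial_def by (rule exI[of _ "\<lambda>i. c * a i"])
qed

lemma degree_q_polynomial_less:
  assumes "q_polynomial q n f" and "q > 1"
  shows "degree f < q ^ n"
proof -
  obtain a where a: "f = (\<Sum>i<n. monom (a i) (q ^ i))"
    using assms by (auto simp: q_polynomial_def)
  have "degree (monom (a i) (q ^ i)) < q ^ n" if "i < n" for i
    using that assms(2) by (intro le_less_trans[OF degree_monom_le] power_strict_increasing)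
  thus ?thesis
    unfolding a using assms(2) by (intro degree_sum_less) auto
qed

section \<open>A criterion for equivalence of two codes\<close>

text \<open>As \<open>g\<close> undoes \<open>e f\<close> up to the factor \<open>c\<close>, right
  composition with \<open>e f\<close> turns \<open>a x + b g\<close> into
  \<open>b c x + a e f\<close>: the two generators trade places.\<close>

lemma q_equivalent_code_of:
  fixes f g :: "'a::{field,finite} poly"
  assumes card: "CARD('a) = q ^ n" and q: "q > 1" and f: "q_polynomial q n f"
    and e: "e \<noteq> 0" and c: "c \<noteq> 0" and inv: "\<And>x. poly g (e * poly f x) = c * x"
  shows "q_equivalent q n (code_of g) (code_of f)"
proof -
  have N: "q ^ n > 1"
    using card_mono[of UNIV "{0, 1 :: 'a}"] card by simp
  hence n: "n > 0"
    by (cases n) auto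
  have X: "q_polynomial q n (monom a 1)" for a :: 'a
    using q_polynomial_monom[OF n, of q a] by simp
  \<comment> \<open>A left inverse up to the nonzero scalar \<open>c\<close> gives injectivity;
    finiteness then gives bijectivity.\<close>
  have "inj (poly (smult e f))"
    by (rule injI) (metis inv c mult_cancel_left poly_smult)
  hence "bij (poly (smult e f))"
    by (metis bij_def finite finite_UNIV_inj_surj)
  hence L: "invertible_q_polynomial q n (smult e f)"
    using f by (simp add: invertible_q_polynomial_def q_polynomial_smult)
  have "poly (monom (1 :: 'a) 1) = id"
    by (simp add: fun_eq_iff poly_monom)
  hence I: "invertible_q_polynomial q n (monom (1 :: 'a) 1)"
    using X[of 1] by (simp add: invertible_q_polynomial_def)
  have comp: "qcomp q n (monom 1 1) (qcomp q n (map_poly id (monom a 1 + smult b g)) (smult e f))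
      = monom (b * c) 1 + smult (a * e) f" for a b
  proof (rule qcomp_eqI[OF card N])
    show "degree (monom (b * c) 1 + smult (a * e) f) < q ^ n"
      by (intro degree_q_polynomial_less q_polynomial_add q_polynomial_smult X f q)
  qed (simp add: poly_qcomp[OF card] poly_monom inv algebra_simps)
  have "code_of f = {qcomp q n (monom 1 1) (qcomp q n (map_poly id \<phi>) (smult e f)) | \<phi>. \<phi> \<in> code_of g}"
    (is "_ = ?R")
  proof (intro equalityI subsetI)
    fix p assume "p \<in> code_of f"
    then obtain a b where "p = monom a 1 + smult b f"
      by (auto simp: code_of_def)
    \<comment> \<open>The preimage coefficients solve \<open>b' * c = a\<close> and
      \<open>a' * e = b\<close>.\<close>
    hence "p = qcomp q n (monom 1 1)
        (qcomp q n (map_poly id (monom (b / e) 1 + smult (a / c) g)) (smult e f))"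
      unfolding comp using e c by simp
    thus "p \<in> ?R"
      unfolding code_of_def by blast
  next
    fix p assume "p \<in> ?R"
    then obtain a b where "p = qcomp q n (monom 1 1)
        (qcomp q n (map_poly id (monom a 1 + smult b g)) (smult e f))"
      unfolding code_of_def by blast
    thus "p \<in> code_of f"
      unfolding comp code_of_def by blast
  qed
  moreover have "field_automorphism (id :: 'a \<Rightarrow> 'a)"
    by (simp add: field_automorphism_def)
  ultimately show ?thesis
    unfolding q_equivalent_def using L I by blast
qed

section \<open>The adjoint, computed term by term\<close>

lemma adjoint_poly_add:
  fixes f g :: "'a::{field,finite} poly"
  assumes "primepow q" and "CARD('a) = q ^ n"
  shows "adjoint_poly q n (f + g) = adjoint_poly q n f + adjoint_poly q n g"
  by (simp add: adjoint_poly_def add_power_primepow[OF assms] add_monom[symmetric] sum.distrib algebra_simps)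

lemma adjoint_poly_monom:
  assumes "q > 1" and "0 < i" and "i < n"
  shows "adjoint_poly q n (monom c (q ^ i)) = monom (c ^ (q ^ (n - i))) (q ^ (n - i))"
proof -
  have "(\<Sum>j=1..<n. monom (coeff (monom c (q ^ i)) (q ^ j) ^ (q ^ (n - j))) (q ^ (n - j)))
      = (\<Sum>j\<in>{i}. monom (coeff (monom c (q ^ i)) (q ^ j) ^ (q ^ (n - j))) (q ^ (n - j)))"
    using assms by (intro sum.mono_neutral_right) (auto simp: power_inject_exp)
  \<comment> \<open>This removes the separate linear term of the adjoint.\<close>
  moreover have "q ^ i \<noteq> 1"
    using assms by simp
  ultimately show ?thesis
    by (simp add: adjoint_poly_def)
qed

section \<open>The adjoint of psi composed with a multiple of psi\<close>

text \<open>\<open>P\<close> is the map of psi, and the left side is its adjoint at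
  \<open>e * P x\<close>, with the Frobenius powers replaced by abstract ring endomorphisms. The
  claim thus becomes a rational identity in conjugates of \<open>h\<close> and
  \<open>x\<close>.\<close>

lemma adjoint_psi_comp_scaled_psi:
  fixes s r T :: "'a::field \<Rightarrow> 'a" and h x :: 'a
  assumes add: "\<And>x y. s (x + y) = s x + s y" "\<And>x y. r (x + y) = r x + r y" "\<And>x y. T (x + y) = T x + T y"
    and mult: "\<And>x y. s (x * y) = s x * s y" "\<And>x y. r (x * y) = r x * r y" "\<And>x y. T (x * y) = T x * T y"
    and inv: "\<And>x. s (r x) = x" "\<And>x. r (s x) = x" "\<And>x. T (T x) = x"
    and comm: "\<And>x. T (s x) = s (T x)" "\<And>x. T (r x) = r (T x)"
    and h: "h * T h = -1" and k: "s h * r h \<noteq> 1"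
    and e: "e * (h * (s h * r h - 1)) = r h"
  defines "P \<equiv> \<lambda>x. s x + T (r x) + h * s h * s (T x) + h / r h * r x"
  shows "s h / h * s (e * P x) + T (r (e * P x)) / (h * r h) + s (T (e * P x)) + r (e * P x)
     = (1 - s h * r h) / (h * r h) * x"
proof -
  have z: "s 0 = 0" "r 0 = 0" "T 0 = 0"
    using add by (metis add_cancel_right_right)+
  have h0: "h \<noteq> 0" using h by auto
  have nz: "s y \<noteq> 0" "r y \<noteq> 0" "T y \<noteq> 0" if "y \<noteq> 0" for y
    using that z inv by metis+
  have one: "s 1 = 1" "r 1 = 1" "T 1 = 1" using mult nz(1-3)[of 1] by (metis mult_cancel_right2 mult_1 zero_neq_one)+
  have neg: "s (- y) = - s y" "r (- y) = - r y" "T (- y) = - T y" for y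
    using add z by (metis add.right_inverse add_eq_0_iff)+
  have sub: "s (y - w) = s y - s w" "r (y - w) = r y - r w" "T (y - w) = T y - T w" for y w
    using add neg by (metis uminus_add_conv_diff)+
  have inve: "s (inverse y) = inverse (s y)" "r (inverse y) = inverse (r y)" "T (inverse y) = inverse (T y)" for y
    using mult one z by (metis inverse_zero inverse_unique right_inverse)+
  have dv: "s (y / w) = s y / s w" "r (y / w) = r y / r w" "T (y / w) = T y / T w" for y w
    by (simp_all add: divide_inverse mult inve)
  have Th: "T h = -1 / h" using h h0 by (simp add: field_simps)
  define D where "D = s h * r h - 1"
  have D: "D \<noteq> 0" using k by (simp add: D_def)
  have e': "e = r h / (h * D)" using e D h0 by (simp add: field_simps D_def)
  define a where "a = s h"
  define b where "b = r h"
  define c where "c = s (s h)"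
  define d where "d = r (r h)"
  note abcd_defs = a_def b_def c_def d_def
  have abcd: "a \<noteq> 0" "b \<noteq> 0" "c \<noteq> 0" "d \<noteq> 0" using nz h0 by (auto simp: abcd_defs)
  \<comment> \<open>These are \<open>s D\<close> and \<open>r D\<close>.\<close>
  have nn: "c * h - 1 \<noteq> 0" "h * d - 1 \<noteq> 0"
    using nz(1,2)[OF D] by (simp_all add: D_def sub mult inv one abcd_defs)
  have se: "s e = h / (a * (c * h - 1))" and re: "r e = d / (b * (h * d - 1))"
    by (simp_all add: e' dv mult sub inv one D_def abcd_defs)
  have T': "T a = - 1 / a" "T b = - 1 / b" "T c = - 1 / c" "T d = - 1 / d"
     by (simp_all add: abcd_defs comm Th dv neg one)
  have Tse: "T (s e) = a * c / (1 - c * h)"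
    using abcd nn h0 by (simp add: se dv mult sub one T' Th) (simp add: field_simps)
  have Tre: "T (r e) = b * h / (1 - h * d)"
    using abcd nn h0 by (simp add: re dv mult sub one T' Th) (simp add: field_simps)
  define X1 where "X1 = s (s x)"
  define X2 where "X2 = s (s (T x))"
  define X3 where "X3 = r (r x)"
  define X4 where "X4 = r (r (T x))"
  define X5 where "X5 = T x"
  note X_defs = X1_def X2_def X3_def X4_def X5_def
  have sP: "s (P x) = X1 + X5 + a * c * X2 + a / h * x"
    by (simp add: P_def add mult dv inv comm abcd_defs X_defs)
  have rP: "r (P x) = x + X4 + b * h * X5 + b / d * X3"
    by (simp add: P_def add mult dv inv comm abcd_defs X_defs)
  \<comment> \<open>The involution \<open>T\<close> swaps the conjugates of \<open>x\<close> in
    pairs, so no new ones arise.\<close>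
  have TX: "T X1 = X2" "T X2 = X1" "T X3 = X4" "T X4 = X3" "T X5 = x" "T x = X5"
    by (simp_all add: comm inv X_defs)
  have TsP: "T (s (P x)) = X2 + x + X1 / (a * c) + h / a * X5"
    using h0 by (simp add: sP add mult dv TX T' Th)
  have TrP: "T (r (P x)) = X5 + X3 + x / (b * h) + d / b * X4"
    using h0 by (simp add: rP add mult dv TX T' Th)
  \<comment> \<open>Regrouping pairs the terms with denominator \<open>c * h - 1\<close> and those
    with \<open>h * d - 1\<close>, up to sign.\<close>
  have "s h / h * s (e * P x) + T (r (e * P x)) / (h * r h) + s (T (e * P x)) + r (e * P x)
    = a / h * (s e * s (P x)) + T (s e) * T (s (P x)) + (T (r e) * T (r (P x)) / (h * b) + r e * r (P x))"
    by (simp add: mult comm abcd_defs)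
  also have "a / h * (s e * s (P x)) + T (s e) * T (s (P x)) = - X5 - a / h * x"
  proof -
    \<comment> \<open>\<open>M\<close> is \<open>a * c * T (s (P x))\<close>. The other numerator
      differs from it by a multiple of \<open>c * h - 1\<close>, so the fractions cancel and only
      the quotient survives.\<close>
    define M where "M = a * c * X2 + a * c * x + X1 + c * h * X5"
    have "a / h * (s e * s (P x)) = (X1 + X5 + a * c * X2 + a / h * x) / (c * h - 1)"
      unfolding se sP using abcd h0 by simp
    also have "X1 + X5 + a * c * X2 + a / h * x = M + (c * h - 1) * (- X5 - a / h * x)"
      using h0 by (simp add: M_def field_simps)
    finally have "a / h * (s e * s (P x)) = M / (c * h - 1) + (- X5 - a / h * x)"
      using nn by (simp add: add_divide_distrib)
    moreover have "T (s e) * T (s (P x)) = - (M / (c * h - 1))"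
      unfolding Tse TsP M_def using abcd h0 nn by (simp add: divide_simps) (simp add: algebra_simps)
    ultimately show ?thesis by simp
  qed
  also have "T (r e) * T (r (P x)) / (h * b) + r e * r (P x) = X5 + x / (b * h)"
  proof -
    \<comment> \<open>Likewise \<open>M\<close> is \<open>d / b * r (P x)\<close>, and division by
      \<open>1 - h * d\<close> leaves the surviving quotient.\<close>
    define M where "M = d / b * x + d / b * X4 + h * d * X5 + X3"
    have "T (r e) * T (r (P x)) / (h * b) = (X5 + X3 + x / (b * h) + d / b * X4) / (1 - h * d)"
      unfolding Tre TrP using abcd h0 by simp
    also have "X5 + X3 + x / (b * h) + d / b * X4 = M + (1 - h * d) * (X5 + x / (b * h))"
      using h0 abcd by (simp add: M_def field_simps)
    finally have "T (r e) * T (r (P x)) / (h * b) = M / (1 - h * d) + (X5 + x / (b * h))"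
      using nn by (simp add: add_divide_distrib)
    moreover have "r e * r (P x) = - (M / (1 - h * d))"
      unfolding re rP M_def using abcd h0 nn by (simp add: divide_simps) (simp add: algebra_simps)
    ultimately show ?thesis by simp
  qed
  also have "- X5 - a / h * x + (X5 + x / (b * h)) = (1 - s h * r h) / (h * r h) * x"
    using abcd h0 by (simp add: abcd_defs field_simps)
  finally show ?thesis .
qed

section \<open>Nonvanishing of the denominator \<open>s h * r h - 1\<close>\<close>

lemma power_swap_iterate:
  fixes h :: "'a::field"
  assumes "h ^ (q ^ 2) = inverse h"
  shows "h ^ (q ^ (2 * m)) = (if even m then h else inverse h)"
proof (induction m)
  case (Suc m)
  have "q ^ (2 * Suc m) = q ^ (2 * m) * q ^ 2"
    by (metis power_add mult_Suc_right add.commute)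
  hence "h ^ (q ^ (2 * Suc m)) = (h ^ (q ^ (2 * m))) ^ (q ^ 2)"
    by (simp only: power_mult)
  thus ?case
    by (simp only: Suc.IH) (simp add: assms power_inverse)
qed simp

lemma power_q_mult_power_q_inverse_neq_1:
  fixes h :: "'a::{field,finite}"
  assumes q: "odd q" and t: "t > 0" and card: "CARD('a) = q ^ (2 * t)"
    and sub: "h \<notin> GF_subfield (q ^ t)" and h: "h ^ (q ^ t + 1) = -1"
  shows "h ^ q * h ^ (q ^ (2 * t - 1)) \<noteq> 1"
proof
  assume 1: "h ^ q * h ^ (q ^ (2 * t - 1)) = 1"
  have full: "h ^ (q ^ (2 * t)) = h"
    using finite_field_power_CARD[of h] card by simp
  have h0: "h \<noteq> 0"
    using h by auto
  have T: "h ^ (q ^ t) = - inverse h"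
    using h h0 by (simp add: field_simps)
  \<comment> \<open>Raising the assumed relation to the power \<open>q\<close> turns its second
    factor into \<open>h\<close>, so the \<open>q ^ 2\<close>-th power inverts
    \<open>h\<close>.\<close>
  have "q ^ (2 * t - 1) * q = q ^ (2 * t)"
    using t by (simp flip: power_Suc2)
  hence "(h ^ q * h ^ (q ^ (2 * t - 1))) ^ q = h ^ (q ^ 2) * h"
    by (simp only: power_mult_distrib power_mult[symmetric] power2_eq_square full)
  hence "h ^ (q ^ 2) * h = 1"
    by (simp only: 1 power_one)
  hence "h ^ (q ^ 2) = inverse h"
    by (metis inverse_unique mult.commute)
  note iter = power_swap_iterate[OF this]
  show False
  proof (cases "even t")
    case True
    then obtain m where "t = 2 * m" by blast
    \<comment> \<open>The value \<open>h\<close> would put \<open>h\<close> in the subfield; the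
      value \<open>inverse h\<close> would equal \<open>- inverse h\<close>, impossible in odd
      characteristic.\<close>
    have "h ^ (q ^ t) \<in> {h, inverse h}"
      unfolding \<open>t = 2 * m\<close> iter by simp
    moreover have "h ^ (q ^ t) \<noteq> h"
      using sub by (simp add: GF_subfield_def)
    ultimately have "inverse h + inverse h = 0"
      using T by simp
    moreover have "(2 :: 'a) \<noteq> 0"
      using card q by (intro two_neq_zero_odd_CARD) simp
    ultimately show False
      using h0 by (simp flip: mult_2)
  next
    case False
    \<comment> \<open>For odd \<open>t\<close>, iterating \<open>t\<close> times inverts
      \<open>h\<close>, yet the full Frobenius power fixes it. So \<open>h\<close> is 1 or -1, which
      lies in the subfield.\<close>
    hence "inverse h = h"
      using iter[of t] full by (simp only: if_False)
    hence "h\<^sup>2 = 1"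
      using h0 by (metis power2_eq_square right_inverse)
    hence "h = 1 \<or> h = -1"
      by (simp add: power2_eq_1_iff)
    hence "h ^ (q ^ t) = h"
      using q by auto
    thus False
      using sub by (simp add: GF_subfield_def)
  qed
qed

section \<open>Psi and its adjoint in terms of \<open>s\<close>, \<open>r\<close>, \<open>T\<close>
  and conjugates of \<open>h\<close>\<close>

theorem theorem4p6:
  fixes q t n :: nat and h :: "'a::{field,finite}"
  assumes "primepow q" and "odd q" and "t \<ge> 3" and "n = 2 * t"
    and "CARD('a) = q ^ n"
    and "h \<notin> GF_subfield (q ^ t)" and "h ^ (q ^ t + 1) = -1"
  shows "q_equivalent q n (code_of (adjoint_poly q n (psi q t h))) (code_of (psi q t h))"
proof -
  note n = assms(4) and t = assms(3) and card = assms(5)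
  define s where "s = (\<lambda>x :: 'a. x ^ q)"
  define r where "r = (\<lambda>x :: 'a. x ^ (q ^ (2 * t - 1)))"
  define T where "T = (\<lambda>x :: 'a. x ^ (q ^ t))"
  note defs = s_def r_def T_def
  have q1: "q > 1"
    using assms(1) primepow_gt_Suc_0 by auto
  have full: "x ^ (q ^ (2 * t + i)) = x ^ (q ^ i)" for x :: 'a and i
    using finite_field_power_CARD[of x] card by (simp add: n power_add power_mult)
  have add: "s (x + y) = s x + s y" "r (x + y) = r x + r y" "T (x + y) = T x + T y" for x y
    using add_power_primepow[OF assms(1) card, of x y] add_power_primepow[OF assms(1) card, of x y 1]
    by (simp_all add: defs)
  have mult: "s (x * y) = s x * s y" "r (x * y) = r x * r y" "T (x * y) = T x * T y" for x y
    by (simp_all add: defs power_mult_distrib)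
  have divide: "s (x / y) = s x / s y" for x y
    by (simp add: defs power_divide)
  have inv: "s (r x) = x" "r (s x) = x" "T (T x) = x" for x
    using full[of x 0] t
    by (simp_all add: defs power_mult[symmetric] power_add[symmetric] mult_2
        power_Suc[symmetric] power_Suc2[symmetric] del: power_Suc)
  have comm: "T (s x) = s (T x)" "T (r x) = r (T x)" for x
    by (simp_all add: defs power_mult[symmetric] mult.commute)
  have sT: "x ^ (q ^ (t + 1)) = s (T x)" for x
    by (simp add: defs power_mult[symmetric] mult.commute)
  have Tr: "x ^ (q ^ (t - 1)) = T (r x)" for x
  proof -
    have "T (r x) = x ^ (q ^ (2 * t - 1 + t))"
      by (simp add: defs power_mult[symmetric] power_add[symmetric])
    also have "2 * t - 1 + t = 2 * t + (t - 1)"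
      using t by simp
    finally show ?thesis
      by (simp add: full)
  qed
  have h0: "h \<noteq> 0"
    using assms(7) by auto
  have h: "h * T h = -1"
    using assms(7) by (simp add: defs)
  hence Th: "T h = - 1 / h"
    using h0 by (simp add: field_simps)
  have powi: "h powi (1 - int m) = h / h ^ m" for m
    by (simp add: power_int_diff h0)
  have "h powi (1 - int (q ^ (t + 1))) = h / s (T h)"
    unfolding powi sT ..
  \<comment> \<open>Oddness of \<open>q\<close> gives
    \<open>s (- 1 / h) = - 1 / s h\<close>.\<close>
  also have "\<dots> = - (h * s h)"
    unfolding Th using assms(2) h0 by (simp add: defs power_divide)
  finally have c1: "h powi (1 - int (q ^ (t + 1))) = - (h * s h)" .
  have c2: "h powi (1 - int (q ^ (2 * t - 1))) = h / r h"
    unfolding powi by (simp add: defs)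
  \<comment> \<open>The minus sign in psi is absorbed by \<open>c1\<close>; writing
    \<open>q ^ 1\<close> lets the monomial rule for the adjoint apply.\<close>
  have psi: "psi q t h = monom 1 (q ^ 1) + monom 1 (q ^ (t - 1))
      + monom (h * s h) (q ^ (t + 1)) + monom (h / r h) (q ^ (2 * t - 1))"
    unfolding psi_def c1 c2 by (simp add: minus_monom[symmetric])
  have idx: "n - 1 = 2 * t - 1" "n - (t - 1) = t + 1" "n - (t + 1) = t - 1" "n - (2 * t - 1) = 1"
    "0 < t - 1" "t - 1 < n" "0 < t + 1" "t + 1 < n" "0 < 2 * t - 1" "2 * t - 1 < n"
    "0 < (1 :: nat)" "1 < n"
    using n t by auto
  have adj: "adjoint_poly q n (psi q t h) = monom 1 (q ^ (2 * t - 1)) + monom 1 (q ^ (t + 1))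
      + monom ((h * s h) ^ q ^ (t - 1)) (q ^ (t - 1)) + monom ((h / r h) ^ q ^ 1) (q ^ 1)"
    unfolding psi
    by (simp only: adjoint_poly_add[OF assms(1) card] adjoint_poly_monom[OF q1] idx power_one)
  have poly_psi: "poly (psi q t h) x = s x + T (r x) + h * s h * s (T x) + h / r h * r x" for x
    unfolding psi by (simp only: poly_add poly_monom sT Tr) (simp add: defs)
  \<comment> \<open>Since \<open>r\<close> undoes \<open>s\<close>, this is
    \<open>T (r h) * T h\<close>, and the two signs cancel.\<close>
  have "T (r (h * s h)) = 1 / (h * r h)"
    using assms(2) by (simp add: mult inv comm Th) (simp add: defs power_divide)
  moreover have "(h / r h) ^ q = s h / h"
    using divide[of h "r h"] by (simp add: inv) (simp add: defs)
  ultimately have poly_adj: "poly (adjoint_poly q n (psi q t h)) x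
      = s h / h * s x + T (r x) / (h * r h) + s (T x) + r x" for x
    unfolding adj
    by (simp only: poly_add poly_monom sT Tr power_one_right) (simp add: s_def r_def)
  define e where "e = r h / (h * (s h * r h - 1))"
  have k: "s h * r h \<noteq> 1"
    using power_q_mult_power_q_inverse_neq_1[of q t h] assms by (simp add: defs)
  have nz: "r h \<noteq> 0"
    using h0 by (simp add: defs)
  have e: "e * (h * (s h * r h - 1)) = r h"
    using k h0 by (simp add: e_def)
  show ?thesis
  proof (rule q_equivalent_code_of[OF card q1])
    show "q_polynomial q n (psi q t h)"
      unfolding psi using n t by (intro q_polynomial_add q_polynomial_monom) auto
    show "e \<noteq> 0"
      using k h0 nz by (simp add: e_def)
    show "(1 - s h * r h) / (h * r h) \<noteq> 0"
      using k h0 nz by (metis divide_eq_0_iff eq_iff_diff_eq_0 mult_eq_0_iff)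
    show "poly (adjoint_poly q n (psi q t h)) (e * poly (psi q t h) x) = (1 - s h * r h) / (h * r h) * x" for x
      unfolding poly_adj poly_psi
      by (rule adjoint_psi_comp_scaled_psi[where s = s and r = r and T = T, OF add mult inv comm h k e])
  qed
qed

end
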